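(* Let $n\ge 2$, $d\ge 1$, $w,\varepsilon,\tau,\delta>0$, let $Q\subset\mathbb{R}^d$ be convex and compact, and let $\bm{x} = [x_1^T\ \dots\ x_n^T]^T\in\mathcal{D}$ be a feasible configuration, where $$\mathcal{D} = \{\bm{x}\in Q^n : g(\bm{x})\le 0,\ g_{ij}(\bm{x})\le 0 \text{ for all } 1\le i<j\le n\}.$$ Let $i\in\{1,\dots,n\}$ be an index such that for some $1\le k\le d$ one has $x_i^{(k)}\le x_j^{(k)}$ for all $j\ne i$ and $x_i^{(k)}<x_j^{(k)}$ for some $j\neq i$. If the vertex $i$ (i.e. the node $x_i$) is isolated in the graph $G_\delta(\bm{x})$, then $\bm{x}$ satisfies the Mangasarian-Fromowitz Constraint Qualification (MFCQ), i.e. there exists $\bar{\bm{d}}\in\mathbb{R}^{nd}$ such that $$g(\bm{x}) = 0 \Rightarrow \nabla g(\bm{x})^T\bar{\bm{d}}<0, \qquad g_{lm}(\bm{x}) = 0\Rightarrow \nabla g_{lm}(\bm{x})^T\bar{\bm{d}}<0\quad \text{for all } 1\le l<m\le n.$$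
   Context: For node positions $x_1,\dots,x_n\in\mathbb{R}^d$ stacked into $\bm{x}\in\mathbb{R}^{nd}$, $x_i^{(k)}$ denotes the $k$-th component of $x_i$. The weighted adjacency matrix $A(\bm{x}) = (a_{ij}(\bm{x}))\in\mathbb{R}^{n\times n}$ is defined by $a_{ii}(\bm{x}) = 0$ and $a_{ij}(\bm{x}) = \sigma_w(\varepsilon - \|x_i-x_j\|)$ for $i\ne j$, where $\sigma_w(y) = 1/(1+e^{-wy})$, $w>0$, $\varepsilon>0$, and $\|\cdot\|$ is the Euclidean norm. The weighted Laplacian is $\mathcal{L}(\bm{x}) = \Delta(\bm{x}) - A(\bm{x})$, where $\Delta(\bm{x})$ is the diagonal matrix with $i$-th diagonal entry $\sum_{j=1}^n a_{ij}(\bm{x})$. $P = [p_1\ \dots\ p_{n-1}]\in\mathbb{R}^{n\times(n-1)}$ is a fixed matrix with orthonormal columns satisfying $p_i^T\bm{1}_n = 0$ for all $i$, where $\bm{1}_n$ is the all-ones vector. Define $g(\bm{x}) = \tau - \det(P^T\mathcal{L}(\bm{x})P)$ and $g_{ij}(\bm{x}) = \delta - \|x_i-x_j\|$ for $1\le i<j\le n$; these are functions of $\bm{x}\in\mathbb{R}^{nd}$, differentiable wherever the nodes are pairwise distinct. $G_\delta(\bm{x})$ is the graph on vertex set $\{1,\dots,n\}$ in which distinct $i,j$ are adjacent if and only if $\|x_i-x_j\| = \delta$; a vertex is isolated if it has no neighbours. *)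

theory Defs
  imports "HOL-Analysis.Analysis"
begin

text \<open>
  A configuration of \<open>n\<close> nodes in \<open>d\<close>-dimensional space is a vector \<open>x :: real^'d^'n\<close>, with
  node \<open>x $ i\<close> and \<open>x $ i $ k\<close> its \<open>k\<close>-th component. The inner product of \<open>real^'d^'n\<close> is
  that of the stacked vector of length \<open>nd\<close>.
  The vertex set \<open>{1..n}\<close> is the finite linearly ordered type \<open>'n\<close>; the columns of \<open>P\<close> are indexed
  by a type \<open>'m\<close> with \<open>n - 1\<close> elements.
\<close>

definition sigma :: "real \<Rightarrow> real \<Rightarrow> real" where
  "sigma w y = 1 / (1 + exp (- (w * y)))"

definition adjacency :: "real \<Rightarrow> real \<Rightarrow> real^'d^'n \<Rightarrow> real^'n^'n" where
  "adjacency w \<epsilon> x = (\<chi> i j. if i = j then 0 else sigma w (\<epsilon> - norm (x $ i - x $ j)))"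

definition degree_matrix :: "real^'n^'n \<Rightarrow> real^'n^'n" where
  "degree_matrix A = (\<chi> i j. if i = j then (\<Sum>l\<in>UNIV. A $ i $ l) else 0)"

definition laplacian :: "real \<Rightarrow> real \<Rightarrow> real^'d^'n \<Rightarrow> real^'n^'n" where
  "laplacian w \<epsilon> x = degree_matrix (adjacency w \<epsilon> x) - adjacency w \<epsilon> x"

text \<open>Here \<open>vec 1\<close> is the all-ones vector.\<close>

definition orthonormal_complement_of_ones :: "real^'m^'n \<Rightarrow> bool" where
  "orthonormal_complement_of_ones P \<longleftrightarrow>
     (\<forall>i j. column i P \<bullet> column j P = (if i = j then 1 else 0)) \<and>
     (\<forall>i. column i P \<bullet> vec 1 = 0)"

definition g_conn :: "real \<Rightarrow> real \<Rightarrow> real \<Rightarrow> real^'m^'n \<Rightarrow> real^'d^'n \<Rightarrow> real" where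
  "g_conn w \<epsilon> \<tau> P x = \<tau> - det (transpose P ** laplacian w \<epsilon> x ** P)"

definition g_dist :: "real \<Rightarrow> 'n \<Rightarrow> 'n \<Rightarrow> real^'d^'n \<Rightarrow> real" where
  "g_dist \<delta> i j x = \<delta> - norm (x $ i - x $ j)"

definition feasible ::
  "(real^'d) set \<Rightarrow> real \<Rightarrow> real \<Rightarrow> real \<Rightarrow> real \<Rightarrow> real^'m^'n::{finite,linorder} \<Rightarrow>
   (real^'d^'n::{finite,linorder}) set" where
  "feasible Q w \<epsilon> \<tau> \<delta> P =
     {x. (\<forall>i. x $ i \<in> Q) \<and> g_conn w \<epsilon> \<tau> P x \<le> 0 \<and> (\<forall>i j. i < j \<longrightarrow> g_dist \<delta> i j x \<le> 0)}"

definition delta_adjacent :: "real \<Rightarrow> real^'d^'n \<Rightarrow> 'n \<Rightarrow> 'n \<Rightarrow> bool" where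
  "delta_adjacent \<delta> x i j \<longleftrightarrow> i \<noteq> j \<and> norm (x $ i - x $ j) = \<delta>"

definition isolated_vertex :: "('v \<Rightarrow> 'v \<Rightarrow> bool) \<Rightarrow> 'v \<Rightarrow> bool" where
  "isolated_vertex E i \<longleftrightarrow> (\<nexists>j. E i j)"

text \<open>
  The gradient is meaningful only at points of differentiability (otherwise \<open>THE\<close> yields an
  unspecified vector).
\<close>

definition gradient :: "('a::real_inner \<Rightarrow> real) \<Rightarrow> 'a \<Rightarrow> 'a" where
  "gradient f x = (THE D. GDERIV f x :> D)"

lemma gradient_eqI:
  assumes "GDERIV f x :> D"
  shows "gradient f x = D"
  unfolding gradient_def
proof (rule the_equality[where P = "\<lambda>D. GDERIV f x :> D", OF assms])
  fix D' assume "GDERIV f x :> D'"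
  then have "(\<lambda>h. h \<bullet> D') = (\<lambda>h. h \<bullet> D)"
    using assms unfolding gderiv_def by (rule has_derivative_unique)
  then show "D' = D"
    by (metis inner_commute vector_eq_rdot)
qed

definition MFCQ ::
  "real \<Rightarrow> real \<Rightarrow> real \<Rightarrow> real \<Rightarrow> real^'m^'n::{finite,linorder} \<Rightarrow> real^'d^'n::{finite,linorder} \<Rightarrow> bool" where
  "MFCQ w \<epsilon> \<tau> \<delta> P x \<longleftrightarrow>
     (\<exists>v.
        (g_conn w \<epsilon> \<tau> P x = 0 \<longrightarrow> gradient (g_conn w \<epsilon> \<tau> P) x \<bullet> v < 0) \<and>
        (\<forall>l m. l < m \<longrightarrow> g_dist \<delta> l m x = 0 \<longrightarrow> gradient (g_dist \<delta> l m) x \<bullet> v < 0))"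

end

theory Submission
  imports Defs
begin

text \<open>
  Take the direction \<open>x + t *\<^sub>R E\<close>, where \<open>E\<close> moves only node \<open>i\<close>, along the \<open>k\<close>-th axis. Along \<open>x\<close>
  every distance grows linearly, so the active distance constraints strictly decrease; they do not
  involve the isolated node \<open>i\<close>, so \<open>E\<close> leaves them unchanged. Along \<open>E\<close> no distance increases to
  first order, hence no weight decreases, and at least one weight increases. By Jacobi's formula the
  derivative of \<open>det (P\<^sup>T L P)\<close> is a combination of these weight derivatives with positive
  coefficients, so for large \<open>t\<close> the connectivity constraint strictly decreases as well.
\<close>

section \<open>Gradients\<close>

text \<open>The Riesz representative of \<open>f'\<close> is \<open>adjoint f' 1\<close>. Every
  later gradient enters only through its inner product with a direction, so Frechet derivatives
  suffice and no gradient vector has to be computed.\<close>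

lemma gradient_inner:
  fixes f :: "'a::euclidean_space \<Rightarrow> real"
  assumes "(f has_derivative f') (at x)"
  shows "gradient f x \<bullet> v = f' v"
proof -
  have f': "f' h = h \<bullet> adjoint f' 1" for h
    using adjoint_works[OF has_derivative_linear[OF assms], of h 1] by simp
  have "GDERIV f x :> adjoint f' 1"
    unfolding gderiv_def using assms f' by (metis (no_types, lifting) ext)
  then show ?thesis
    using gradient_eqI f' by (metis inner_commute)
qed

section \<open>Jacobi's formula\<close>

lemma differentiable_det:
  fixes M :: "real^'m^'m"
  shows "det differentiable (at M)"
proof -
  have entry: "((\<lambda>A :: real^'m^'m. A $ i $ j) has_derivative (\<lambda>A. A $ i $ j)) (at M)" for i j
    by (intro bounded_linear_imp_has_derivative bounded_linear_compose[OF bounded_linear_vec_nth]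
        bounded_linear_vec_nth)
  have "(det has_derivative (\<lambda>B. \<Sum>p | p permutes UNIV. of_int (sign p) *
      (\<Sum>i\<in>UNIV. B $ i $ p i * (\<Prod>j\<in>UNIV - {i}. M $ j $ p j)))) (at M)"
    unfolding det_def[abs_def]
    by (intro has_derivative_sum has_derivative_mult_right has_derivative_prod entry)
  then show ?thesis
    by (rule differentiableI)
qed

text \<open>Writing the direction as \<open>M ** Y\<close> avoids the adjugate and any inverse of
  \<open>M\<close>. By linearity of \<open>D\<close> the direction may be split into its columns,
  and changing a single column of \<open>M\<close> is the situation of Cramer's rule.\<close>

lemma det_derivative_eq_trace:
  fixes M Y :: "real^'m^'m"
  assumes "(det has_derivative D) (at M)"
  shows "D (M ** Y) = trace Y * det M"
proof -
  interpret D: linear D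
    using assms by (rule has_derivative_linear)
  define C :: "'m \<Rightarrow> real^'m^'m" where "C k = (\<chi> i j. if j = k then (M ** Y) $ i $ k else 0)" for k
  have C: "D (C k) = Y $ k $ k * det M" for k
  proof -
    have det_line: "det (M + s *\<^sub>R C k) = (1 + s * Y $ k $ k) * det M" for s
    proof -
      \<comment> \<open>Only column \<open>k\<close> changes, and the new column is \<open>M\<close>
        applied to \<open>axis k 1 + s *\<^sub>R column k Y\<close>. Cramer's rule multiplies
        \<open>det M\<close> by the \<open>k\<close>-th entry of that vector,
        \<open>1 + s * Y $ k $ k\<close>.\<close>
      have "M + s *\<^sub>R C k =
          (\<chi> i j. if j = k then (M *v (axis k 1 + s *\<^sub>R column k Y)) $ i else M $ i $ j)"
        by (simp add: C_def vec_eq_iff matrix_vector_right_distrib matrix_vector_mult_basis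
            matrix_vector_mult_scaleR)
          (simp add: matrix_vector_mult_def matrix_matrix_mult_def column_def)
      then show ?thesis
        using cramer_lemma[of k M "axis k 1 + s *\<^sub>R column k Y"] by (simp add: column_def axis_def)
    qed
    have "((\<lambda>s. M + s *\<^sub>R C k) has_derivative (\<lambda>s. s *\<^sub>R C k)) (at 0)"
      by (auto intro!: derivative_eq_intros)
    then have "((\<lambda>s. det (M + s *\<^sub>R C k)) has_derivative (\<lambda>s. D (s *\<^sub>R C k))) (at 0)"
      using has_derivative_compose[of "\<lambda>s. M + s *\<^sub>R C k" "\<lambda>s. s *\<^sub>R C k" 0 UNIV det D] assms
      by simp
    moreover have "((\<lambda>s. det (M + s *\<^sub>R C k)) has_derivative (\<lambda>s. s * Y $ k $ k * det M)) (at 0)"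
      unfolding det_line by (auto intro!: derivative_eq_intros)
    ultimately have "(\<lambda>s. D (s *\<^sub>R C k)) = (\<lambda>s. s * Y $ k $ k * det M)"
      by (rule has_derivative_unique)
    then show ?thesis
      by (metis scaleR_one mult_1)
  qed
  have "M ** Y = (\<Sum>k\<in>UNIV. C k)"
    by (simp add: C_def vec_eq_iff)
  then show ?thesis
    by (simp add: D.sum C trace_def sum_distrib_right)
qed

section \<open>The reduced Laplacian\<close>

definition dyad :: "real^'m \<Rightarrow> real^'m^'m" where
  "dyad b = (\<chi> i j. b $ i * b $ j)"

lemma dyad_mult_vec: "dyad b *v y = (b \<bullet> y) *\<^sub>R b"
  by (simp add: vec_eq_iff dyad_def matrix_vector_mult_def inner_vec_def sum_distrib_left mult_ac)

lemma sum_mult_vec: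
  fixes A :: "'i \<Rightarrow> real^'m^'n"
  shows "(\<Sum>p\<in>S. A p) *v y = (\<Sum>p\<in>S. A p *v y)"
  by (induction S rule: infinite_finite_induct) (simp_all add: matrix_vector_mult_add_rdistrib)

text \<open>A Laplacian is the sum over edges of weight times the dyad of e_p - e_q, and the
  transpose of \<open>P\<close> maps e_p - e_q to the difference of rows \<open>p\<close> and
  \<open>q\<close> of \<open>P\<close>. The factor 1/2 appears because ordered pairs count each edge
  twice.\<close>

lemma reduced_laplacian_eq_sum_dyads:
  fixes P :: "real^'m^'n"
  shows "transpose P ** laplacian w \<epsilon> x ** P =
    (\<Sum>p\<in>UNIV. \<Sum>q\<in>UNIV. (adjacency w \<epsilon> x $ p $ q / 2) *\<^sub>R dyad (P $ p - P $ q))"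
proof -
  define a where "a p q = adjacency w \<epsilon> x $ p $ q" for p q
  have sym: "a p q = a q p" for p q
    by (simp add: a_def adjacency_def norm_minus_commute)
  have entry: "(transpose P ** laplacian w \<epsilon> x ** P) $ k $ l =
      (\<Sum>p\<in>UNIV. \<Sum>q\<in>UNIV. a p q / 2 * ((P $ p $ k - P $ q $ k) * (P $ p $ l - P $ q $ l)))" for k l
  proof -
    have lap: "laplacian w \<epsilon> x $ p $ q = (if p = q then \<Sum>r\<in>UNIV. a p r else 0) - a p q" for p q
      by (simp add: laplacian_def degree_matrix_def a_def)
    have "(transpose P ** laplacian w \<epsilon> x ** P) $ k $ l =
        (\<Sum>q\<in>UNIV. \<Sum>p\<in>UNIV. P $ p $ k * laplacian w \<epsilon> x $ p $ q * P $ q $ l)"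
      by (simp add: matrix_matrix_mult_def transpose_def sum_distrib_right)
    also have "\<dots> = (\<Sum>q\<in>UNIV. \<Sum>p\<in>UNIV. (if p = q then P $ p $ k * (\<Sum>r\<in>UNIV. a p r) * P $ q $ l else 0))
        - (\<Sum>q\<in>UNIV. \<Sum>p\<in>UNIV. P $ p $ k * a p q * P $ q $ l)"
      unfolding lap sum_subtractf[symmetric]
      by (intro sum.cong refl) (auto simp: algebra_simps)
    also have "\<dots> = (\<Sum>p\<in>UNIV. \<Sum>q\<in>UNIV. a p q * (P $ p $ k * P $ p $ l))
        - (\<Sum>p\<in>UNIV. \<Sum>q\<in>UNIV. a p q * (P $ q $ k * P $ p $ l))"
      by (simp add: sum_distrib_left sum_distrib_right mult_ac sym)
    finally have l: "(transpose P ** laplacian w \<epsilon> x ** P) $ k $ l = \<dots>" .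
    \<comment> \<open>Expanding the product of differences gives two square and two cross sums. By
      symmetry of \<open>a\<close> they agree in pairs, which cancels the factor 1/2.\<close>
    have s1: "(\<Sum>p\<in>UNIV. \<Sum>q\<in>UNIV. a p q * (P $ q $ k * P $ q $ l)) =
        (\<Sum>p\<in>UNIV. \<Sum>q\<in>UNIV. a p q * (P $ p $ k * P $ p $ l))"
      by (subst sum.swap) (simp add: sym)
    have s2: "(\<Sum>p\<in>UNIV. \<Sum>q\<in>UNIV. a p q * (P $ p $ k * P $ q $ l)) =
        (\<Sum>p\<in>UNIV. \<Sum>q\<in>UNIV. a p q * (P $ q $ k * P $ p $ l))"
      by (subst sum.swap) (simp add: sym)
    have "(\<Sum>p\<in>UNIV. \<Sum>q\<in>UNIV. a p q / 2 * ((P $ p $ k - P $ q $ k) * (P $ p $ l - P $ q $ l))) =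
        ((\<Sum>p\<in>UNIV. \<Sum>q\<in>UNIV. a p q * (P $ p $ k * P $ p $ l))
        + (\<Sum>p\<in>UNIV. \<Sum>q\<in>UNIV. a p q * (P $ q $ k * P $ q $ l))
        - (\<Sum>p\<in>UNIV. \<Sum>q\<in>UNIV. a p q * (P $ q $ k * P $ p $ l))
        - (\<Sum>p\<in>UNIV. \<Sum>q\<in>UNIV. a p q * (P $ p $ k * P $ q $ l))) / 2"
      unfolding sum_divide_distrib sum.distrib[symmetric] sum_subtractf[symmetric]
      by (intro sum.cong refl) (simp add: field_simps)
    then show ?thesis
      unfolding l s1 s2 by simp
  qed
  show ?thesis
    unfolding vec_eq_iff entry by (simp add: dyad_def a_def)
qed

text \<open>
  If \<open>M\<close> is invertible and \<open>b = M u\<close>, then \<open>dyad b = M ** Y\<close> for the rank-one matrix \<open>Y\<close> with entries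
  \<open>u\<^sub>i b\<^sub>j\<close>, whose trace \<open>u \<bullet> M u\<close> is positive.
\<close>

lemma det_derivative_dyad_pos:
  fixes M :: "real^'m^'m" and c :: "'i \<Rightarrow> real"
  assumes M: "M = (\<Sum>p\<in>S. c p *\<^sub>R dyad (B p))"
    and fin: "finite S" and c: "\<And>p. p \<in> S \<Longrightarrow> 0 \<le> c p"
    and det: "0 < det M" and D: "(det has_derivative D) (at M)" and b: "b \<noteq> 0"
  shows "0 < D (dyad b)"
proof -
  have "invertible M"
    using det by (simp add: invertible_det_nz)
  then obtain N where N: "M ** N = mat 1"
    unfolding invertible_def by blast
  define u where "u = N *v b"
  have u: "M *v u = b"
    by (simp add: u_def matrix_vector_mul_assoc N)
  have Mu: "M *v u = (\<Sum>p\<in>S. (c p * (B p \<bullet> u)) *\<^sub>R B p)"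
    unfolding M sum_mult_vec by (simp add: dyad_mult_vec flip: scaleR_matrix_vector_assoc)
  have quad: "u \<bullet> b = (\<Sum>p\<in>S. c p * (B p \<bullet> u)\<^sup>2)"
    unfolding u[symmetric] Mu by (simp add: inner_sum_right power2_eq_square inner_commute mult_ac)
  have nonneg: "0 \<le> u \<bullet> b"
    unfolding quad using c by (intro sum_nonneg mult_nonneg_nonneg) auto
  \<comment> \<open>If the quadratic form vanishes, so does each of its nonnegative terms, hence
    each coefficient in \<open>Mu\<close>; then \<open>M *v u\<close> is 0, although it equals
    \<open>b\<close>.\<close>
  have "u \<bullet> b \<noteq> 0"
  proof
    assume "u \<bullet> b = 0"
    then have "\<forall>p\<in>S. c p * (B p \<bullet> u)\<^sup>2 = 0"
      unfolding quad using c fin by (subst (asm) sum_nonneg_eq_0_iff) auto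
    then have "M *v u = 0"
      unfolding Mu by (intro sum.neutral) auto
    with u b show False by simp
  qed
  moreover have "dyad b = M ** (\<chi> i j. u $ i * b $ j)"
    unfolding u[symmetric] dyad_def
    by (simp add: vec_eq_iff matrix_matrix_mult_def matrix_vector_mult_def sum_distrib_right mult_ac)
  then have "D (dyad b) = (u \<bullet> b) * det M"
    using det_derivative_eq_trace[OF D] by (simp add: trace_def inner_vec_def)
  ultimately show ?thesis
    using nonneg det by simp
qed

text \<open>Dimension count: a nonzero \<open>z\<close>, the all-ones vector and the n - 1 columns
  of \<open>P\<close> would be n + 1 nonzero, pairwise orthogonal vectors in a space of dimension
  n.\<close>

lemma orthonormal_complement_of_ones_eq_0:
  fixes P :: "real^'m^'n" and z :: "real^'n"
  assumes P: "orthonormal_complement_of_ones P" and card: "CARD('m) = CARD('n) - 1"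
    and z: "z \<bullet> vec 1 = 0" "\<And>i. column i P \<bullet> z = 0"
  shows "z = 0"
proof (rule ccontr)
  assume "z \<noteq> 0"
  define C where "C = range (\<lambda>i. column i P)"
  have orth: "column i P \<bullet> column j P = (if i = j then 1 else 0)" and one: "column i P \<bullet> vec 1 = 0" for i j
    using P by (auto simp: orthonormal_complement_of_ones_def)
  have "inj (\<lambda>i. column i P)"
    by (rule injI) (metis orth zero_neq_one)
  then have cardC: "card C = CARD('m)"
    by (simp add: C_def card_image)
  have v1: "(vec 1 :: real^'n) \<noteq> 0"
    by (simp add: vec_eq_iff)
  have "pairwise orthogonal (insert z (insert (vec 1) C))"
    using orth one z
    by (auto simp: pairwise_insert C_def orthogonal_def inner_commute)
      (auto simp: pairwise_def orthogonal_def)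
  moreover have "0 \<notin> insert z (insert (vec 1) C)"
    using \<open>z \<noteq> 0\<close> v1 orth by (auto simp: C_def) (metis inner_zero_left zero_neq_one)
  ultimately have "independent (insert z (insert (vec 1) C))"
    by (rule pairwise_orthogonal_independent)
  then have "card (insert z (insert (vec 1) C)) \<le> CARD('n)"
    using independent_bound by fastforce
  moreover have "vec 1 \<notin> C"
    using one v1 unfolding C_def by (metis imageE inner_eq_zero_iff)
  moreover have "z \<notin> insert (vec 1) C"
    using z \<open>z \<noteq> 0\<close> unfolding C_def by (metis imageE inner_eq_zero_iff insertE)
  moreover have "finite C"
    by (simp add: C_def)
  ultimately have "CARD('m) + 2 \<le> CARD('n)"
    by (simp add: cardC)
  with card show False by simp
qed

text \<open>Equal rows would make e_p - e_q orthogonal to every column of \<open>P\<close>, and it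
  is always orthogonal to the all-ones vector. This makes every off-diagonal dyad in the reduced
  Laplacian nonzero.\<close>

lemma orthonormal_complement_of_ones_rows_distinct:
  fixes P :: "real^'m^'n"
  assumes "orthonormal_complement_of_ones P" and "CARD('m) = CARD('n) - 1" and "p \<noteq> q"
  shows "P $ p \<noteq> P $ q"
proof
  assume eq: "P $ p = P $ q"
  have "axis p 1 - axis q 1 = (0 :: real^'n)"
    by (rule orthonormal_complement_of_ones_eq_0[OF assms(1,2)])
      (simp_all add: inner_diff_left inner_diff_right inner_axis inner_axis' column_def eq)
  then have "(axis p 1 - axis q 1 :: real^'n) $ p = 0" by simp
  with \<open>p \<noteq> q\<close> show False by (simp add: axis_def)
qed

section \<open>Derivatives of the constraints\<close>

lemma norm_diff_has_derivative:
  fixes x :: "real^'d^'n"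
  assumes "x $ p \<noteq> x $ q"
  shows "((\<lambda>y. norm (y $ p - y $ q)) has_derivative (\<lambda>v. (v $ p - v $ q) \<bullet> sgn (x $ p - x $ q))) (at x)"
proof -
  have "((\<lambda>y. y $ p - y $ q) has_derivative (\<lambda>v. v $ p - v $ q)) (at x)"
    by (intro has_derivative_diff bounded_linear_imp_has_derivative bounded_linear_vec_nth)
  from has_derivative_compose[OF this has_derivative_norm] show ?thesis
    using assms by simp
qed

lemma sigma_has_real_derivative:
  "(sigma w has_real_derivative w * exp (- (w * y)) / (1 + exp (- (w * y)))\<^sup>2) (at y)"
proof -
  have "1 + exp (- (w * y)) \<noteq> 0"
    using exp_gt_zero[of "- (w * y)"] by linarith
  then show ?thesis
    unfolding sigma_def[abs_def]
    by (auto intro!: derivative_eq_intros simp: power2_eq_square)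
qed

text \<open>The factor \<open>s p q\<close> is the slope of \<open>sigma\<close> at \<open>\<epsilon> - norm (x $ p - x $ q)\<close>.\<close>

lemma adjacency_has_derivative:
  fixes x :: "real^'d^'n"
  assumes "w > 0" and "\<And>p q. p \<noteq> q \<Longrightarrow> x $ p \<noteq> x $ q"
  obtains s :: "'n \<Rightarrow> 'n \<Rightarrow> real" where "\<And>p q. 0 < s p q"
    "\<And>p q. ((\<lambda>y. adjacency w \<epsilon> y $ p $ q) has_derivative
        (\<lambda>v. - s p q * ((v $ p - v $ q) \<bullet> sgn (x $ p - x $ q)))) (at x)"
proof -
  define e where "e p q = exp (- (w * (\<epsilon> - norm (x $ p - x $ q))))" for p q
  define s where "s p q = w * e p q / (1 + e p q)\<^sup>2" for p q
  have e: "0 < e p q" for p q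
    by (simp add: e_def)
  have pos: "0 < s p q" for p q
    unfolding s_def using \<open>w > 0\<close> e[of p q] by (intro divide_pos_pos mult_pos_pos zero_less_power) auto
  have "((\<lambda>y. adjacency w \<epsilon> y $ p $ q) has_derivative
        (\<lambda>v. - s p q * ((v $ p - v $ q) \<bullet> sgn (x $ p - x $ q)))) (at x)" for p q
  proof (cases "p = q")
    case True
    then show ?thesis by (simp add: adjacency_def)
  next
    case False
    have "((\<lambda>y. \<epsilon> - norm (y $ p - y $ q)) has_derivative
        (\<lambda>v. 0 - (v $ p - v $ q) \<bullet> sgn (x $ p - x $ q))) (at x)"
      using assms(2)[OF False] by (intro has_derivative_diff has_derivative_const norm_diff_has_derivative)
    from has_derivative_compose[OF this sigma_has_real_derivative[unfolded has_field_derivative_def]]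
    show ?thesis
      using False by (simp add: adjacency_def s_def e_def)
  qed
  with pos show ?thesis by (rule that)
qed

lemma adjacency_nonneg: "0 \<le> adjacency w \<epsilon> x $ p $ q"
  by (simp add: adjacency_def sigma_def add_nonneg_nonneg)

text \<open>Chain rule through the dyad expansion. Two minus signs cancel, one from
  \<open>\<tau> - det\<close> and one from weights that fall as distances grow, so the constraint
  responds to each distance rate with a positive coefficient.\<close>

lemma g_conn_has_derivative:
  fixes x :: "real^'d^'n" and P :: "real^'m^'n"
  assumes "w > 0" and dist: "\<And>p q. p \<noteq> q \<Longrightarrow> x $ p \<noteq> x $ q"
    and P: "orthonormal_complement_of_ones P" "CARD('m) = CARD('n) - 1"
    and det: "0 < det (transpose P ** laplacian w \<epsilon> x ** P)"
  obtains r :: "'n \<Rightarrow> 'n \<Rightarrow> real" where "\<And>p q. p \<noteq> q \<Longrightarrow> 0 < r p q"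
    "(g_conn w \<epsilon> \<tau> P has_derivative
        (\<lambda>v. \<Sum>p\<in>UNIV. \<Sum>q\<in>UNIV. r p q * ((v $ p - v $ q) \<bullet> sgn (x $ p - x $ q)))) (at x)"
proof -
  define M where "M y = transpose P ** laplacian w \<epsilon> y ** P" for y :: "real^'d^'n"
  have M: "M y = (\<Sum>p\<in>UNIV. \<Sum>q\<in>UNIV. (adjacency w \<epsilon> y $ p $ q / 2) *\<^sub>R dyad (P $ p - P $ q))" for y
    unfolding M_def by (rule reduced_laplacian_eq_sum_dyads)
  obtain D where D: "(det has_derivative D) (at (M x))"
    using differentiable_det unfolding differentiable_def by blast
  interpret D: linear D
    using D by (rule has_derivative_linear)
  obtain s :: "'n \<Rightarrow> 'n \<Rightarrow> real" where s: "\<And>p q. 0 < s p q"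
    and a': "\<And>p q. ((\<lambda>y. adjacency w \<epsilon> y $ p $ q) has_derivative
        (\<lambda>v. - s p q * ((v $ p - v $ q) \<bullet> sgn (x $ p - x $ q)))) (at x)"
    using adjacency_has_derivative[OF \<open>w > 0\<close> dist] by blast
  have pos: "0 < D (dyad (P $ p - P $ q))" if "p \<noteq> q" for p q
  proof (rule det_derivative_dyad_pos[OF _ _ _ _ D])
    \<comment> \<open>The double sum is flattened to one index set of pairs, the shape that
      \<open>det_derivative_dyad_pos\<close> expects.\<close>
    have "M x = (\<Sum>(p, q)\<in>UNIV. (adjacency w \<epsilon> x $ p $ q / 2) *\<^sub>R dyad (P $ p - P $ q))"
      unfolding M by (simp add: sum.cartesian_product)
    then show "M x = (\<Sum>pq\<in>UNIV. (adjacency w \<epsilon> x $ fst pq $ snd pq / 2) *\<^sub>R dyad (P $ fst pq - P $ snd pq))"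
      by (simp add: case_prod_beta)
    show "0 < det (M x)"
      using det by (simp add: M_def)
    show "P $ p - P $ q \<noteq> 0"
      using orthonormal_complement_of_ones_rows_distinct[OF P that] by simp
  qed (simp_all add: adjacency_nonneg)
  have "(M has_derivative (\<lambda>v. \<Sum>p\<in>UNIV. \<Sum>q\<in>UNIV.
      (- s p q * ((v $ p - v $ q) \<bullet> sgn (x $ p - x $ q)) / 2) *\<^sub>R dyad (P $ p - P $ q))) (at x)"
    unfolding M[abs_def] divide_inverse
    by (intro has_derivative_sum has_derivative_scaleR_left has_derivative_mult_left a')
  from has_derivative_compose[OF this D]
  have "((\<lambda>y. \<tau> - det (M y)) has_derivative (\<lambda>v. 0 - D (\<Sum>p\<in>UNIV. \<Sum>q\<in>UNIV.
      (- s p q * ((v $ p - v $ q) \<bullet> sgn (x $ p - x $ q)) / 2) *\<^sub>R dyad (P $ p - P $ q)))) (at x)"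
    by (intro has_derivative_diff has_derivative_const)
  then have "(g_conn w \<epsilon> \<tau> P has_derivative (\<lambda>v. \<Sum>p\<in>UNIV. \<Sum>q\<in>UNIV.
      s p q * D (dyad (P $ p - P $ q)) / 2 * ((v $ p - v $ q) \<bullet> sgn (x $ p - x $ q)))) (at x)"
    unfolding g_conn_def[abs_def] M_def
    by (simp add: D.sum D.scale D.neg sum_negf mult_ac)
  with s pos show ?thesis
    by (intro that[of "\<lambda>p q. s p q * D (dyad (P $ p - P $ q)) / 2"]) simp_all
qed

lemma gradient_g_dist:
  fixes x :: "real^'d^'n"
  assumes "x $ l \<noteq> x $ m"
  shows "gradient (g_dist \<delta> l m) x \<bullet> v = - ((v $ l - v $ m) \<bullet> sgn (x $ l - x $ m))"
proof -
  have "(g_dist \<delta> l m has_derivative (\<lambda>v. 0 - (v $ l - v $ m) \<bullet> sgn (x $ l - x $ m))) (at x)"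
    unfolding g_dist_def[abs_def]
    using assms by (intro has_derivative_diff has_derivative_const norm_diff_has_derivative)
  from gradient_inner[OF this] show ?thesis by simp
qed

section \<open>The constraint qualification\<close>

theorem theoremV2:
  fixes x :: "real^'d^'n::{finite,linorder}"
    and P :: "real^'m^'n::{finite,linorder}"
    and Q :: "(real^'d) set"
    and w \<epsilon> \<tau> \<delta> :: real
    and i :: 'n
  assumes "CARD('n) \<ge> 2"
    and "CARD('m) = CARD('n) - 1"
    and "w > 0" and "\<epsilon> > 0" and "\<tau> > 0" and "\<delta> > 0"
    and "orthonormal_complement_of_ones P"
    and "convex Q" and "compact Q"
    and "x \<in> feasible Q w \<epsilon> \<tau> \<delta> P"
    and "\<exists>k. (\<forall>j. j \<noteq> i \<longrightarrow> x $ i $ k \<le> x $ j $ k) \<and> (\<exists>j. j \<noteq> i \<and> x $ i $ k < x $ j $ k)"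
    and "isolated_vertex (delta_adjacent \<delta> x) i"
  shows "MFCQ w \<epsilon> \<tau> \<delta> P x"
proof -
  have far: "\<delta> \<le> norm (x $ p - x $ q)" if "p \<noteq> q" for p q
    using that assms(10) norm_minus_commute[of "x $ p" "x $ q"]
    by (cases p q rule: linorder_cases) (force simp: feasible_def g_dist_def)+
  have dist: "x $ p \<noteq> x $ q" if "p \<noteq> q" for p q
    using far[OF that] \<open>\<delta> > 0\<close> by auto
  \<comment> \<open>Feasibility gives a determinant of at least \<open>\<tau>\<close>.\<close>
  have det: "0 < det (transpose P ** laplacian w \<epsilon> x ** P)"
    using assms(10) \<open>\<tau> > 0\<close> by (simp add: feasible_def g_conn_def)
  obtain k j where le: "\<And>p. x $ i $ k \<le> x $ p $ k" and j: "j \<noteq> i" "x $ i $ k < x $ j $ k"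
    using assms(11) by (metis order_refl)
  define E :: "real^'d^'n::{finite,linorder}" where "E = axis i (axis k 1)"
  \<comment> \<open>For distinct \<open>p\<close> and \<open>q\<close> this is the directional
    derivative at \<open>x\<close>, along \<open>v\<close>, of the distance between the two nodes.
    Along \<open>x\<close> itself it equals that distance.\<close>
  define rate where "rate v p q = (v $ p - v $ q) \<bullet> sgn (x $ p - x $ q)" for v :: "real^'d^'n::{finite,linorder}" and p q
  have rate_add: "rate (x + t *\<^sub>R E) p q = rate x p q + t * rate E p q" for t p q
    by (simp add: rate_def inner_add_left inner_diff_left algebra_simps)
  have rate_x: "0 < rate x p q" if "p \<noteq> q" for p q
    using dist[OF that] by (simp add: rate_def sgn_div_norm power2_norm_eq_inner[symmetric])
  have axis_sgn: "axis k 1 \<bullet> sgn z = z $ k / norm z" for z :: "real^'d"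
    by (simp add: sgn_div_norm inner_axis' divide_inverse mult.commute)
  have rate_E: "rate E p q = (if p = q then 0 else if p = i then (x $ i $ k - x $ q $ k) / norm (x $ i - x $ q)
      else if q = i then (x $ i $ k - x $ p $ k) / norm (x $ p - x $ i) else 0)" for p q
    by (auto simp: rate_def E_def axis_def[of i] axis_sgn diff_divide_distrib)
  \<comment> \<open>Node \<open>i\<close> is minimal in coordinate \<open>k\<close>, so raising that
    coordinate moves it away from no other node to first order.\<close>
  have rate_E_nonpos: "rate E p q \<le> 0" for p q
    unfolding rate_E using le by (auto intro!: divide_nonpos_nonneg)
  have rate_E_neg: "rate E i j < 0"
    unfolding rate_E using j dist[of i j] by (auto intro!: divide_neg_pos)
  obtain r :: "'n \<Rightarrow> 'n \<Rightarrow> real" where r: "\<And>p q. p \<noteq> q \<Longrightarrow> 0 < r p q"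
    and conn: "(g_conn w \<epsilon> \<tau> P has_derivative (\<lambda>v. \<Sum>p\<in>UNIV. \<Sum>q\<in>UNIV. r p q * rate v p q)) (at x)"
    using g_conn_has_derivative[OF \<open>w > 0\<close> dist assms(7,2) det, of \<tau>] unfolding rate_def by blast
  \<comment> \<open>The sign of \<open>r\<close> is unknown on the diagonal, but the rate vanishes
    there.\<close>
  have slope: "r p q * rate E p q \<le> 0" for p q
    using r[of p q] rate_E_nonpos[of p q] rate_E[of p p]
    by (cases "p = q") (auto intro: mult_nonneg_nonpos)
  define a where "a = (\<Sum>p\<in>UNIV. \<Sum>q\<in>UNIV. r p q * rate x p q)"
  define b where "b = (\<Sum>p\<in>UNIV. \<Sum>q\<in>UNIV. r p q * rate E p q)"
  \<comment> \<open>All terms are nonpositive, so dropping every one except the strictly negative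
    term at \<open>i\<close>, \<open>j\<close> only increases the sum.\<close>
  have "b \<le> (\<Sum>q\<in>UNIV. r i q * rate E i q)"
    unfolding b_def by (subst sum.remove[of _ i]) (auto intro!: sum_nonpos slope)
  also have "\<dots> \<le> r i j * rate E i j"
    by (subst sum.remove[of _ j]) (auto intro!: sum_nonpos slope)
  also have "\<dots> < 0"
    using r[of i j] rate_E_neg j by (intro mult_pos_neg) auto
  finally have "b < 0" .
  \<comment> \<open>Chosen so that \<open>t * b\<close> is \<open>- (\<bar>a\<bar> + 1)\<close>,
    hence \<open>a + t * b\<close> is at most -1.\<close>
  define t where "t = (\<bar>a\<bar> + 1) / - b"
  have "gradient (g_conn w \<epsilon> \<tau> P) x \<bullet> (x + t *\<^sub>R E) = a + t * b"
    unfolding gradient_inner[OF conn] a_def b_def rate_add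
    by (simp add: algebra_simps sum.distrib sum_distrib_left)
  also have "\<dots> < 0"
    using \<open>b < 0\<close> by (simp add: t_def)
  finally have "gradient (g_conn w \<epsilon> \<tau> P) x \<bullet> (x + t *\<^sub>R E) < 0" .
  moreover have "gradient (g_dist \<delta> l m) x \<bullet> (x + t *\<^sub>R E) < 0" if "l < m" and active: "g_dist \<delta> l m x = 0" for l m
  proof -
    have "l \<noteq> m" using \<open>l < m\<close> by simp
    \<comment> \<open>An active distance constraint is an edge of the graph, so isolation keeps it
      away from \<open>i\<close>. The \<open>E\<close> part then contributes nothing, whatever the
      size of \<open>t\<close>, and the derivative is \<open>- rate x l m\<close>.\<close>
    moreover have "l \<noteq> i" "m \<noteq> i"
      using assms(12) active \<open>l \<noteq> m\<close> norm_minus_commute[of "x $ l" "x $ m"]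
      by (auto simp: isolated_vertex_def delta_adjacent_def g_dist_def)
    ultimately have "rate E l m = 0"
      by (simp add: rate_E)
    with \<open>l \<noteq> m\<close> show ?thesis
      using gradient_g_dist[OF dist, of l m \<delta> "x + t *\<^sub>R E"] rate_add[of t l m] rate_x[of l m]
      by (simp add: rate_def)
  qed
  ultimately show ?thesis
    unfolding MFCQ_def by blast
qed

end
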